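(* As $K\to\infty$, $$\sum_{2\le k\le K}|E_k|\le\sum_{2\le k\le K}a_k\ll K(\log K)^3.$$
   Context: $\tau(n)$ is the number of positive divisors of $n$; $\log$ is the natural logarithm. For $k\ge2$, $$E_k=\{\tau(k^2-j)-j:\ 1\le j\le 2k-2,\ \tau(k^2-j)\ge j\},$$ $$a_k=\#\{1\le j\le 2k-2:\ \tau(k^2-j)\ge j\}.$$ *)

theory Defs
  imports Complex_Main "HOL-Library.Landau_Symbols"
begin

definition tau :: "nat \<Rightarrow> nat" where
  "tau n = card {d. d dvd n}"

(* Natural-number subtraction never truncates in k^2 - j below: for k \<ge> 2 and
   j \<le> 2 * k - 2 one has k^2 - j \<ge> (k - 1)^2 + 1 > 0.
   The elements tau (k^2 - j) - j are formed in int. *)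

definition J_set :: "nat \<Rightarrow> nat set" where
  "J_set k = {j. 1 \<le> j \<and> j \<le> 2 * k - 2 \<and> tau (k^2 - j) \<ge> j}"

definition E_set :: "nat \<Rightarrow> int set" where
  "E_set k = {int (tau (k^2 - j)) - int j | j. j \<in> J_set k}"

definition a_count :: "nat \<Rightarrow> nat" where
  "a_count k = card (J_set k)"

end

theory Submission
  imports Defs "HOL-Analysis.Harmonic_Numbers" "HOL-Real_Asymp.Real_Asymp"
begin

text \<open>
  The first inequality holds because \<open>E_set k\<close> is an image of \<open>J_set k\<close>. For the second,
  \<open>a_count k\<close> is at most the sum of \<open>tau (k\<^sup>2 - j) / j\<close> over \<open>1 \<le> j \<le> 2 * k - 2\<close>, since a
  counted \<open>j\<close> contributes at least 1. A divisor of \<open>k\<^sup>2 - j\<close> or its cofactor is below \<open>k\<close>, so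
  after exchanging the order of summation it suffices to bound, for \<open>d \<le> K\<close>, the number of
  \<open>k \<le> K\<close> with \<open>k\<^sup>2 \<equiv> j\<close> modulo \<open>d\<close>, and to sum this over \<open>d\<close> and, with weight \<open>1 / j\<close>, over \<open>j\<close>.

  The number of square roots of \<open>j\<close> modulo \<open>d\<close> can be large if \<open>j\<close> and \<open>d\<close> have a common square
  factor, and the point is to have a bound that makes this loss visible and summable without any
  theory of multiplicative functions or characters. Fix one root \<open>x\<close>. Any other root \<open>k\<close> gives
  \<open>d dvd (x - k) * (x + k)\<close>, hence a factorisation \<open>d = e * f\<close> with \<open>e dvd x - k\<close> and
  \<open>f dvd x + k\<close>; this determines \<open>k\<close> modulo \<open>lcm e f = d / h\<close>, where \<open>h = gcd e f\<close>. So each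
  factorisation accounts for at most \<open>K * h / d + 1 \<le> 2 * K * h / d\<close> values of \<open>k\<close>
  (\<open>card_square_roots_mod_le\<close>). The factor \<open>h\<close> is paid for by a divisibility:
  \<open>h\<close> divides \<open>2 * x\<close> and \<open>h\<^sup>2\<close> divides \<open>d\<close>, so \<open>h\<^sup>2\<close> divides \<open>4 * j\<close>
  (\<open>square_roots_mod_factorisation\<close>).

  Summing over \<open>j\<close> first, the condition \<open>h\<^sup>2 dvd 4 * j\<close> saves a factor \<open>4 / h\<^sup>2\<close>
  (\<open>sum_inverse_dvd_mult_le\<close>), which more than compensates \<open>h\<close>. What remains is a
  product of three harmonic sums, one each over \<open>j\<close>, \<open>e\<close> and \<open>f\<close>, and these are the three
  logarithms of the theorem.
\<close>

section \<open>Divisors up to the square root\<close>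

text \<open>
  The complementary divisor of a divisor beyond \<open>k\<close> is below \<open>k\<close>.
\<close>
lemma tau_le_twice_card_small_divisors:
  assumes "0 < n" and "n < k\<^sup>2"
  shows "tau n \<le> 2 * card {d \<in> {1..k}. d dvd n}"
proof -
  let ?A = "{d \<in> {1..k}. d dvd n}"
  have "d \<in> ?A \<union> (\<lambda>d. n div d) ` ?A" if "d dvd n" for d
  proof (cases "d \<le> k")
    case True
    then show ?thesis
      using that assms by (auto intro!: Nat.gr0I)
  next
    case False
    from that obtain c where c: "n = d * c" ..
    have "c < k"
    proof (rule ccontr)
      assume "\<not> c < k"
      then have "k * k \<le> d * c"
        using False by (intro mult_mono) auto
      then show False
        using assms c by (simp add: power2_eq_square)
    qed
    moreover have "c > 0" and "d > 0"
      using assms c by auto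
    ultimately have "c \<in> ?A" and "d = n div c"
      using c by auto
    then show ?thesis by blast
  qed
  then have "{d. d dvd n} \<subseteq> ?A \<union> (\<lambda>d. n div d) ` ?A" by blast
  then have "tau n \<le> card (?A \<union> (\<lambda>d. n div d) ` ?A)"
    unfolding tau_def by (intro card_mono) auto
  also have "\<dots> \<le> card ?A + card ((\<lambda>d. n div d) ` ?A)"
    by (rule card_Un_le)
  also have "\<dots> \<le> card ?A + card ?A"
    by (intro add_left_mono card_image_le) auto
  finally show ?thesis by simp
qed

section \<open>Counting square roots modulo d\<close>

text \<open>
  Such a set meets each of the \<open>K div m + 1\<close> blocks of length \<open>m\<close> that cover \<open>{0..K}\<close> at most
  once.
\<close>
lemma card_congruent_le:
  fixes S :: "nat set"
  assumes "S \<subseteq> {1..K}" and "m > 0"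
    and "\<And>x y. x \<in> S \<Longrightarrow> y \<in> S \<Longrightarrow> int m dvd int x - int y"
  shows "real (card S) \<le> real K / real m + 1"
proof -
  have "inj_on (\<lambda>x. x div m) S"
  proof (rule inj_onI)
    fix x y assume xy: "x \<in> S" "y \<in> S" "x div m = y div m"
    then have "int x mod int m = int y mod int m"
      using assms(3) by (simp add: mod_eq_dvd_iff)
    then have "x mod m = y mod m"
      by (metis of_nat_eq_iff zmod_int)
    then show "x = y"
      using xy(3) by (metis div_mult_mod_eq)
  qed
  moreover have "(\<lambda>x. x div m) ` S \<subseteq> {0..K div m}"
  proof (rule image_subsetI)
    fix x assume "x \<in> S"
    then have "x \<le> K" using assms(1) by auto
    then show "x div m \<in> {0..K div m}" by (simp add: div_le_mono)
  qed
  ultimately have "card S \<le> card {0..K div m}"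
    by (intro card_inj_on_le) auto
  then have "real (card S) \<le> real (K div m) + 1"
    by simp
  also have "real (K div m) \<le> real K / real m"
    by (rule of_nat_div_le_of_nat)
  finally show ?thesis by simp
qed

text \<open>
  The factorisation comes from \<open>e = gcd d (x - y)\<close>: the cofactor \<open>f\<close> is then coprime to
  \<open>(x - y) / e\<close>, so it must divide \<open>x + y\<close>. The last divisibility measures how far \<open>e\<close> and \<open>f\<close>
  are from being coprime: a common divisor of them divides \<open>x - y\<close> and \<open>x + y\<close>, hence \<open>2 * x\<close>,
  while its square divides \<open>d\<close>, modulo which \<open>x\<^sup>2\<close> is \<open>j\<close>.
\<close>
lemma square_roots_mod_factorisation:
  fixes x y d j :: int
  assumes d: "d > 0" and "d dvd x\<^sup>2 - j" and "d dvd y\<^sup>2 - j"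
  obtains e f where "e > 0" "f > 0" "d = e * f" "e dvd x - y" "f dvd x + y"
    "(gcd e f)\<^sup>2 dvd 4 * j"
proof -
  define e where "e = gcd d (x - y)"
  define f where "f = d div e"
  have e: "e > 0" and de: "d = e * f" and exy: "e dvd x - y"
    using d by (auto simp: e_def f_def)
  have f: "f > 0"
    using d de e by (simp add: zero_less_mult_iff)
  have "d dvd (x\<^sup>2 - j) - (y\<^sup>2 - j)"
    using assms(2,3) by (rule dvd_diff)
  also have "(x\<^sup>2 - j) - (y\<^sup>2 - j) = (x - y) * (x + y)"
    by (simp add: algebra_simps power2_eq_square)
  finally have "e * f dvd e * ((x - y) div e) * (x + y)"
    using de exy by simp
  then have "f dvd ((x - y) div e) * (x + y)"
    using e by (simp add: mult.assoc)
  moreover have "coprime f ((x - y) div e)"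
    unfolding f_def e_def using d by (intro div_gcd_coprime) auto
  ultimately have fxy: "f dvd x + y"
    by (simp add: coprime_dvd_mult_right_iff)
  define h where "h = gcd e f"
  have "h dvd (x - y) + (x + y)"
    using exy fxy unfolding h_def by (meson dvd_add dvd_trans gcd_dvd1 gcd_dvd2)
  then have "h\<^sup>2 dvd (2 * x)\<^sup>2"
    by (intro dvd_power_same) simp
  then have "h\<^sup>2 dvd 4 * x\<^sup>2"
    by (simp add: power_mult_distrib)
  moreover have "h\<^sup>2 dvd d"
    unfolding power2_eq_square de h_def by (intro mult_dvd_mono) auto
  then have "h\<^sup>2 dvd 4 * (x\<^sup>2 - j)"
    using assms(2) by (meson dvd_mult dvd_trans)
  ultimately have "h\<^sup>2 dvd 4 * x\<^sup>2 - 4 * (x\<^sup>2 - j)"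
    by (rule dvd_diff)
  then have "(gcd e f)\<^sup>2 dvd 4 * j"
    by (simp add: h_def algebra_simps)
  with e f de exy fxy that show ?thesis by blast
qed

text \<open>
  The roots are sorted, relative to one root \<open>x\<close>, by the divisor \<open>e\<close> of the previous lemma. The
  roots in one class agree with \<open>x\<close> modulo \<open>e\<close> and with \<open>- x\<close> modulo \<open>d div e\<close>, so they form a
  single residue class modulo the least common multiple, which is \<open>d\<close> divided by the greatest
  common divisor.
\<close>
lemma card_square_roots_mod_le:
  fixes d j K :: nat
  assumes d: "0 < d" "d \<le> K"
  shows "real (card {k \<in> {1..K}. int d dvd (int k)\<^sup>2 - int j})
    \<le> (\<Sum>e \<in> {e. e dvd d \<and> (gcd e (d div e))\<^sup>2 dvd 4 * j}. 2 * real K * real (gcd e (d div e)) / real d)"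
    (is "real (card ?R) \<le> sum ?w ?D")
proof (cases "?R = {}")
  case True
  then show ?thesis
    by (simp only: card.empty of_nat_0) (intro sum_nonneg, simp)
next
  case False
  then obtain x where x: "x \<in> ?R" by blast
  define S where "S e = {k \<in> {1..K}. int e dvd int x - int k \<and> int (d div e) dvd int x + int k}" for e
  have finD: "finite ?D"
    using d(1) by (intro finite_subset[OF _ finite_divisors_nat[of d]]) auto
  have "?R \<subseteq> (\<Union>e\<in>?D. S e)"
  proof
    fix k assume k: "k \<in> ?R"
    obtain e f :: int where ef: "e > 0" "f > 0" "int d = e * f" "e dvd int x - int k" "f dvd int x + int k"
      "(gcd e f)\<^sup>2 dvd 4 * int j"
      using square_roots_mod_factorisation[of "int d" "int x" "int j" "int k"] x k d by auto
    define e' f' where "e' = nat e" and "f' = nat f"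
    have e': "e = int e'" "f = int f'" "e' > 0"
      using ef by (auto simp: e'_def f'_def)
    have df: "d = e' * f'"
      using ef(3) unfolding e' by (metis of_nat_eq_iff of_nat_mult)
    have "int ((gcd e' f')\<^sup>2) dvd int (4 * j)"
      using ef(6) unfolding e' by simp
    then have "(gcd e' f')\<^sup>2 dvd 4 * j"
      by (simp only: int_dvd_int_iff)
    then have "e' \<in> ?D"
      using df e' by simp
    moreover have "k \<in> S e'"
      using k ef df e' by (simp add: S_def)
    ultimately show "k \<in> (\<Union>e\<in>?D. S e)" by blast
  qed
  then have "card ?R \<le> card (\<Union>e\<in>?D. S e)"
    using finD by (intro card_mono finite_UN_I) (auto simp: S_def)
  also have "\<dots> \<le> (\<Sum>e\<in>?D. card (S e))"
    using finD by (rule card_UN_le)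
  finally have "real (card ?R) \<le> (\<Sum>e\<in>?D. real (card (S e)))"
    by (simp flip: of_nat_sum)
  also have "\<dots> \<le> sum ?w ?D"
  proof (rule sum_mono)
    fix e assume "e \<in> ?D"
    then obtain f where df: "d = e * f" by (auto elim: dvdE)
    have ef: "e > 0" "f > 0" "d div e = f"
      using d(1) df by auto
    define l where "l = lcm e f"
    have "l * gcd e f = d"
      unfolding l_def df by (metis mult.commute prod_gcd_lcm_nat)
    then have l: "l > 0" "real l * real (gcd e f) = real d"
      using d(1) by (auto intro!: Nat.gr0I simp flip: of_nat_mult)
    have "real (card (S e)) \<le> real K / real l + 1"
    proof (rule card_congruent_le)
      fix u v assume uv: "u \<in> S e" "v \<in> S e"
      have "int e dvd (int x - int v) - (int x - int u)"
        using uv unfolding S_def by (blast intro: dvd_diff)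
      moreover have "int f dvd (int x + int u) - (int x + int v)"
        using uv unfolding S_def ef(3)[symmetric] by (blast intro: dvd_diff)
      ultimately have "lcm (int e) (int f) dvd int u - int v"
        by (intro lcm_least) simp_all
      then show "int l dvd int u - int v"
        by (simp add: l_def)
    qed (use l in \<open>auto simp: S_def\<close>)
    also have "1 / real l = real (gcd e f) / real d"
      using l d by (simp add: field_simps)
    then have "real K / real l = real K * real (gcd e f) / real d"
      by (metis times_divide_eq_right mult.right_neutral)
    \<comment> \<open>Since \<open>d \<le> K\<close>, the rounding term 1 is absorbed by doubling the main term.\<close>
    moreover have "1 \<le> real K * real (gcd e f) / real d"
    proof -
      have "1 \<le> gcd e f" using ef by (simp add: Suc_le_eq)
      then have "d * 1 \<le> K * gcd e f" using d by (intro mult_mono) auto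
      then have "real d \<le> real K * real (gcd e f)"
        by (simp flip: of_nat_mult)
      then show ?thesis using d by simp
    qed
    ultimately show "real (card (S e)) \<le> ?w e"
      using ef by simp
  qed
  finally show ?thesis .
qed

section \<open>Sums of reciprocals\<close>

text \<open>
  Writing \<open>c * j = q * m\<close> turns \<open>1 / j\<close> into \<open>(c / q) * (1 / m)\<close>, with distinct \<open>m \<le> c * J\<close>.
  Keeping the factor \<open>c\<close> inside the divisibility avoids reducing \<open>q\<close> by its common divisor
  with \<open>c\<close>.
\<close>
lemma sum_inverse_dvd_mult_le:
  fixes c q J :: nat
  assumes "c > 0" "q > 0"
  shows "(\<Sum>j\<in>{j\<in>{1..J}. q dvd c * j}. 1 / real j) \<le> real c / real q * harm (c * J)"
proof -
  let ?A = "{j\<in>{1..J}. q dvd c * j}"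
  let ?f = "\<lambda>j. c * j div q"
  have inj: "inj_on ?f ?A"
    using assms by (auto intro!: inj_onI elim!: dvdE) (metis mult_left_cancel neq0_conv nonzero_mult_div_cancel_left)
  have sub: "?f ` ?A \<subseteq> {1..c * J}"
  proof safe
    fix j assume j: "j \<in> {1..J}" "q dvd c * j"
    then obtain m where m: "c * j = q * m" by auto
    have "m > 0" using m j assms by (auto intro: Nat.gr0I)
    moreover have "m \<le> c * J"
    proof -
      have "m \<le> q * m" using assms by simp
      also have "q * m \<le> c * J" using m j by (metis atLeastAtMost_iff mult_le_mono2)
      finally show ?thesis .
    qed
    ultimately show "c * j div q \<in> {1..c * J}"
      using m assms by simp
  qed
  have "(\<Sum>j\<in>?A. 1 / real j) = (\<Sum>j\<in>?A. real c / real q * inverse (real (?f j)))"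
  proof (rule sum.cong)
    fix j assume "j \<in> ?A"
    then show "1 / real j = real c / real q * inverse (real (?f j))"
      using assms by (simp add: real_of_nat_div field_simps)
  qed simp
  also have "\<dots> = real c / real q * (\<Sum>m\<in>?f ` ?A. inverse (real m))"
    using inj by (simp add: sum.reindex sum_distrib_left)
  also have "\<dots> \<le> real c / real q * harm (c * J)"
    unfolding harm_def using sub by (intro mult_left_mono sum_mono2) auto
  finally show ?thesis .
qed

text \<open>
  The factorisations \<open>e * f = d\<close> with \<open>d \<le> K\<close> are the lattice points under a hyperbola. Enlarging
  this region to the full square costs only a constant factor here and lets the two variables
  separate.
\<close>
lemma sum_divisor_pairs_le:
  fixes F :: "nat \<Rightarrow> nat \<Rightarrow> real"
  assumes "\<And>e f. F e f \<ge> 0"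
  shows "(\<Sum>d=1..K. \<Sum>e\<in>{e. e dvd d}. F e (d div e)) \<le> (\<Sum>e=1..K. \<Sum>f=1..K. F e f)"
proof -
  let ?P = "SIGMA d:{1..K}. {e. e dvd d}"
  let ?g = "\<lambda>(d, e). (e, d div e)"
  have "(\<Sum>d=1..K. \<Sum>e\<in>{e. e dvd d}. F e (d div e)) = (\<Sum>p\<in>?P. case_prod F (?g p))"
    by (subst sum.Sigma) (auto simp: case_prod_unfold)
  also have "\<dots> = (\<Sum>p\<in>?g ` ?P. case_prod F p)"
    by (subst sum.reindex) (auto intro!: inj_onI)
  also have "\<dots> \<le> (\<Sum>p\<in>{1..K} \<times> {1..K}. case_prod F p)"
  proof (rule sum_mono2)
    show "?g ` ?P \<subseteq> {1..K} \<times> {1..K}"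
    proof (rule image_subsetI)
      fix p assume "p \<in> ?P"
      then obtain e f where "p = (e * f, e)" "1 \<le> e * f" "e * f \<le> K"
        by (auto elim!: dvdE)
      moreover from this have "e > 0" "f > 0"
        by (auto intro!: Nat.gr0I)
      moreover from this have "e \<le> e * f" "f \<le> e * f"
        by auto
      ultimately have "e \<in> {1..K}" "f \<in> {1..K}" "?g p = (e, f)"
        by (simp_all, linarith+)
      then show "?g p \<in> {1..K} \<times> {1..K}"
        by simp
    qed
  qed (use assms in auto)
  finally show ?thesis
    by (simp add: sum.cartesian_product)
qed

section \<open>The sum over k\<close>

text \<open>
  In the proof, \<open>R j d\<close> is the set of \<open>k \<le> K\<close> that are square roots of \<open>j\<close> modulo \<open>d\<close>, and
  \<open>W j e f\<close> is the contribution of the factorisation \<open>d = e * f\<close> to the bound for its size. The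
  sum over \<open>j\<close> is taken before those over \<open>e\<close> and \<open>f\<close>, because only then does the rarity of the
  \<open>j\<close> with \<open>(gcd e f)\<^sup>2 dvd 4 * j\<close> offset the factor \<open>gcd e f\<close> in \<open>W\<close>.
\<close>
lemma sum_a_count_le:
  "real (\<Sum>k=2..K. a_count k) \<le> 16 * real K * harm (8 * K) * (harm K)\<^sup>2"
proof -
  define R where "R j d = {k \<in> {1..K}. int d dvd (int k)\<^sup>2 - int j}" for j d
  define W where "W j e f = (if (gcd e f)\<^sup>2 dvd 4 * j then 2 * real K * real (gcd e f) / (real e * real f) else 0)"
    for j e f
  have W_nonneg: "W j e f \<ge> 0" for j e f
    by (simp add: W_def)
  have small: "0 < k\<^sup>2 - j \<and> k\<^sup>2 - j < k\<^sup>2 \<and> j \<le> k\<^sup>2" if "2 \<le> k" "1 \<le> j" "j \<le> 2 * k - 2" for k j :: nat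
  proof -
    have "2 * k \<le> k\<^sup>2" using that by (simp add: power2_eq_square)
    then show ?thesis using that by linarith
  qed
  have card_R: "real (card (R j d)) \<le> (\<Sum>e\<in>{e. e dvd d}. W j e (d div e))" if "d \<in> {1..K}" for j d
  proof -
    have "real (card (R j d)) \<le> (\<Sum>e \<in> {e. e dvd d \<and> (gcd e (d div e))\<^sup>2 dvd 4 * j}.
        2 * real K * real (gcd e (d div e)) / real d)"
      unfolding R_def using that by (intro card_square_roots_mod_le) auto
    also have "\<dots> = (\<Sum>e \<in> {e. e dvd d \<and> (gcd e (d div e))\<^sup>2 dvd 4 * j}. W j e (d div e))"
    proof (rule sum.cong)
      fix e assume "e \<in> {e. e dvd d \<and> (gcd e (d div e))\<^sup>2 dvd 4 * j}"
      moreover from this have "real e * real (d div e) = real d"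
        by (simp flip: of_nat_mult)
      ultimately show "2 * real K * real (gcd e (d div e)) / real d = W j e (d div e)"
        by (simp add: W_def)
    qed simp
    also have "\<dots> \<le> (\<Sum>e\<in>{e. e dvd d}. W j e (d div e))"
      using that W_nonneg by (intro sum_mono2) auto
    finally show ?thesis .
  qed
  \<comment> \<open>The condition on \<open>j\<close> is moved into the summand so that the range of \<open>j\<close> is independent of
    \<open>k\<close> and the two sums can be exchanged.\<close>
  have a_le: "real (a_count k) \<le> (\<Sum>j=1..2 * K. if j \<le> 2 * k - 2 then real (tau (k\<^sup>2 - j)) / real j else 0)"
    if "k \<in> {2..K}" for k
  proof -
    have "real (a_count k) = (\<Sum>j\<in>J_set k. 1)"
      by (simp add: a_count_def)
    also have "\<dots> \<le> (\<Sum>j\<in>J_set k. if j \<le> 2 * k - 2 then real (tau (k\<^sup>2 - j)) / real j else 0)"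
      by (intro sum_mono) (auto simp: J_set_def)
    also have "\<dots> \<le> (\<Sum>j=1..2 * K. if j \<le> 2 * k - 2 then real (tau (k\<^sup>2 - j)) / real j else 0)"
      using that by (intro sum_mono2) (auto simp: J_set_def)
    finally show ?thesis .
  qed
  have tau_sum: "(\<Sum>k=2..K. if j \<le> 2 * k - 2 then real (tau (k\<^sup>2 - j)) / real j else 0)
      \<le> 2 / real j * (\<Sum>d=1..K. real (card (R j d)))" if "j \<in> {1..2 * K}" for j
  proof -
    have "(\<Sum>k=2..K. if j \<le> 2 * k - 2 then real (tau (k\<^sup>2 - j)) / real j else 0)
      \<le> (\<Sum>k=2..K. 2 / real j * (\<Sum>d=1..K. if k \<in> R j d then 1 else 0))"
    proof (rule sum_mono)
      fix k assume k: "k \<in> {2..K}"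
      show "(if j \<le> 2 * k - 2 then real (tau (k\<^sup>2 - j)) / real j else 0)
         \<le> 2 / real j * (\<Sum>d=1..K. if k \<in> R j d then 1 else 0)"
      proof (cases "j \<le> 2 * k - 2")
        case True
        note s = small[of k j]
        have "tau (k\<^sup>2 - j) \<le> 2 * card {d \<in> {1..k}. d dvd k\<^sup>2 - j}"
          using s True that k by (intro tau_le_twice_card_small_divisors) auto
        also have "card {d \<in> {1..k}. d dvd k\<^sup>2 - j} \<le> card {d \<in> {1..K}. k \<in> R j d}"
        proof (intro card_mono subsetI)
          fix d assume d: "d \<in> {d \<in> {1..k}. d dvd k\<^sup>2 - j}"
          then have "int d dvd int (k\<^sup>2 - j)" by simp
          also have "int (k\<^sup>2 - j) = (int k)\<^sup>2 - int j"
            using s True that k by (simp add: of_nat_diff)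
          finally show "d \<in> {d \<in> {1..K}. k \<in> R j d}"
            using d k by (simp add: R_def)
        qed simp
        finally have "real (tau (k\<^sup>2 - j)) \<le> 2 * real (card {d \<in> {1..K}. k \<in> R j d})"
          by simp
        also have "real (card {d \<in> {1..K}. k \<in> R j d}) = (\<Sum>d=1..K. if k \<in> R j d then 1 else 0)"
          by (simp add: sum.If_cases Int_def)
        finally show ?thesis
          using True that by (simp add: divide_right_mono)
      qed (simp add: sum_nonneg)
    qed
    also have "\<dots> = 2 / real j * (\<Sum>d=1..K. \<Sum>k=2..K. if k \<in> R j d then 1 else 0)"
      by (subst sum.swap) (simp add: sum_distrib_left)
    also have "\<dots> \<le> 2 / real j * (\<Sum>d=1..K. real (card (R j d)))"
    proof (intro mult_left_mono sum_mono)
      fix d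
      have "card ({2..K} \<inter> R j d) \<le> card (R j d)"
        by (intro card_mono) (auto simp: R_def)
      then show "(\<Sum>k=2..K. if k \<in> R j d then 1 else 0) \<le> real (card (R j d))"
        by (simp add: sum.If_cases)
    qed simp
    finally show ?thesis .
  qed
  have j_sum: "(\<Sum>j=1..2 * K. 2 / real j * W j e f) \<le> 16 * real K * harm (8 * K) * (1 / (real e * real f))"
    if "e \<in> {1..K}" "f \<in> {1..K}" for e f
  proof -
    define h where "h = gcd e f"
    have h: "h \<ge> 1" using that by (simp add: h_def Suc_le_eq)
    have "(\<Sum>j=1..2 * K. 2 / real j * W j e f)
        = (\<Sum>j=1..2 * K. if h\<^sup>2 dvd 4 * j then 4 * real K * real h / (real e * real f) * (1 / real j) else 0)"
      by (intro sum.cong) (auto simp: W_def h_def)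
    also have "\<dots> = 4 * real K * real h / (real e * real f) * (\<Sum>j\<in>{j\<in>{1..2 * K}. h\<^sup>2 dvd 4 * j}. 1 / real j)"
      unfolding sum_distrib_left by (rule sum.inter_filter[symmetric]) simp
    also have "\<dots> \<le> 4 * real K * real h / (real e * real f) * (real 4 / real (h\<^sup>2) * harm (4 * (2 * K)))"
      using h by (intro mult_left_mono sum_inverse_dvd_mult_le) auto
    also have "\<dots> = 16 * real K * harm (8 * K) * (1 / (real e * real f)) * (1 / real h)"
      by (simp add: power2_eq_square)
    \<comment> \<open>A factor \<open>1 / h\<close> is left over; the trivial bound 1 for it already gives the third power
      of the logarithm.\<close>
    also have "\<dots> \<le> 16 * real K * harm (8 * K) * (1 / (real e * real f)) * 1"
      using h by (intro mult_left_mono) (auto simp: harm_nonneg)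
    finally show ?thesis by simp
  qed
  have "real (\<Sum>k=2..K. a_count k)
      \<le> (\<Sum>k=2..K. \<Sum>j=1..2 * K. if j \<le> 2 * k - 2 then real (tau (k\<^sup>2 - j)) / real j else 0)"
    unfolding of_nat_sum by (intro sum_mono a_le)
  also have "\<dots> = (\<Sum>j=1..2 * K. \<Sum>k=2..K. if j \<le> 2 * k - 2 then real (tau (k\<^sup>2 - j)) / real j else 0)"
    by (rule sum.swap)
  also have "\<dots> \<le> (\<Sum>j=1..2 * K. 2 / real j * (\<Sum>d=1..K. real (card (R j d))))"
    by (intro sum_mono tau_sum)
  also have "\<dots> \<le> (\<Sum>j=1..2 * K. 2 / real j * (\<Sum>d=1..K. \<Sum>e\<in>{e. e dvd d}. W j e (d div e)))"
    by (intro sum_mono mult_left_mono card_R) auto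
  also have "\<dots> \<le> (\<Sum>j=1..2 * K. 2 / real j * (\<Sum>e=1..K. \<Sum>f=1..K. W j e f))"
    by (intro sum_mono mult_left_mono sum_divisor_pairs_le W_nonneg) auto
  also have "\<dots> = (\<Sum>e=1..K. \<Sum>f=1..K. \<Sum>j=1..2 * K. 2 / real j * W j e f)"
    by (simp only: sum_distrib_left sum.swap[of _ _ "{1..2 * K}"])
  also have "\<dots> \<le> (\<Sum>e=1..K. \<Sum>f=1..K. 16 * real K * harm (8 * K) * (1 / (real e * real f)))"
    by (intro sum_mono j_sum)
  also have "\<dots> = 16 * real K * harm (8 * K) * (harm K)\<^sup>2"
    unfolding harm_def[of K] power2_eq_square sum_product sum_distrib_left
    by (intro sum.cong) (simp_all add: divide_inverse sum_distrib_left sum_distrib_right mult_ac)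
  finally show ?thesis .
qed

theorem theorem8p3:
  shows "(\<forall>K::nat. (\<Sum>k=2..K. card (E_set k)) \<le> (\<Sum>k=2..K. a_count k)) \<and>
    (\<lambda>K::nat. real (\<Sum>k=2..K. a_count k)) \<in> O[at_top](\<lambda>K. real K * (ln (real K))^3)"
proof (intro conjI allI)
  fix K :: nat
  have "card (E_set k) \<le> a_count k" for k
  proof -
    have "E_set k = (\<lambda>j. int (tau (k\<^sup>2 - j)) - int j) ` J_set k"
      by (auto simp: E_set_def)
    moreover have "finite (J_set k)"
      by (rule finite_subset[of _ "{..2 * k}"]) (auto simp: J_set_def)
    ultimately show ?thesis
      by (simp add: a_count_def card_image_le)
  qed
  then show "(\<Sum>k=2..K. card (E_set k)) \<le> (\<Sum>k=2..K. a_count k)"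
    by (intro sum_mono)
next
  let ?b = "\<lambda>K::nat. 16 * real K * (1 + ln (8 * real K)) * (1 + ln (real K))\<^sup>2"
  have le_b: "real (\<Sum>k=2..K. a_count k) \<le> ?b K" if "K \<ge> 1" for K
  proof -
    have "harm n \<le> 1 + ln (real n)" if "n \<ge> 1" for n
      using euler_mascheroni_sequence_decreasing[of 1 n] that by (simp add: harm_expand)
    from this[of K] this[of "8 * K"] that
    have harm: "harm K \<le> 1 + ln (real K)" "harm (8 * K) \<le> 1 + ln (8 * real K)"
      by simp_all
    have "16 * real K * harm (8 * K) * (harm K)\<^sup>2 \<le> 16 * real K * (1 + ln (8 * real K)) * (harm K)\<^sup>2"
      using harm by (intro mult_right_mono mult_left_mono) auto
    also have "\<dots> \<le> ?b K"
      using harm that by (intro mult_left_mono power_mono) (auto simp: harm_nonneg)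
    finally have "16 * real K * harm (8 * K) * (harm K)\<^sup>2 \<le> ?b K" .
    with sum_a_count_le[of K] show ?thesis by linarith
  qed
  have "norm (real (\<Sum>k=2..K. a_count k)) \<le> norm (?b K)" if "K \<ge> 1" for K
    unfolding real_norm_def abs_of_nat by (rule order_trans[OF le_b[OF that] abs_ge_self])
  then have "eventually (\<lambda>K. norm (real (\<Sum>k=2..K. a_count k)) \<le> norm (?b K)) at_top"
    by (rule eventually_at_top_linorderI)
  then have "(\<lambda>K. real (\<Sum>k=2..K. a_count k)) \<in> O(?b)"
    by (rule landau_o.big_mono)
  also have "?b \<in> O(\<lambda>K. real K * (ln (real K))^3)"
    by real_asymp
  finally show "(\<lambda>K::nat. real (\<Sum>k=2..K. a_count k)) \<in> O[at_top](\<lambda>K. real K * (ln (real K))^3)" .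
qed

end
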